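(* Let $(U,g)$, $U\subset\mathbb{R}^3$, be a Riemannian manifold with coordinates $(x_1,x_2,x_3)$ and metric $g=\sum_{s=1}^3 l_s^2(\xi)\,dx_s^2$, where $\xi=\sum_{s=1}^3\alpha_sx_s$. Then the level surfaces $$P_{\xi_0}=\Big\{(x_1,x_2,x_3)\in U:\ \sum_{s=1}^3\alpha_sx_s=\xi_0\Big\},\qquad \xi_1<\xi_0<\xi_2,$$ endowed with the induced metric, are geodesically parallel. Moreover, each level surface has flat (identically zero) Gaussian curvature and constant mean curvature (depending on $\xi_0$).
   Context: Here $(\alpha_1,\alpha_2,\alpha_3)\in\mathbb{R}^3$ is a nonzero vector, $\xi_1<\xi_2$ are real constants, $U=\{(x_1,x_2,x_3)\in\mathbb{R}^3:\ \xi_1<\sum_s\alpha_sx_s<\xi_2\}$, and the $l_s$ are smooth positive functions of $\xi\in(\xi_1,\xi_2)$. For a Riemannian manifold $M^n$ and a differentiable function $f:M\to\mathbb{R}$, the level submanifolds of $f$ are said to be geodesically parallel if $|\operatorname{grad}f|$ is a nonzero constant along each level submanifold; here this is applied to $f(x)=\sum_s\alpha_sx_s$ on $(U,g)$. The mean curvature is that of $P_{\xi_0}$ as a surface in $(U,g)$. *)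

theory Defs
  imports "HOL-Analysis.Analysis"
begin

section \<open>Smooth maps on open sets\<close>

text \<open>
  All directional derivatives of order at most \<open>n\<close> exist and are continuous on the open set \<open>S\<close>.
\<close>

primrec higher_differentiable_on ::
  "'a::real_normed_vector set \<Rightarrow> ('a \<Rightarrow> 'b::real_normed_vector) \<Rightarrow> nat \<Rightarrow> bool" where
  "higher_differentiable_on S f 0 \<longleftrightarrow> continuous_on S f"
| "higher_differentiable_on S f (Suc n) \<longleftrightarrow>
     (\<forall>x\<in>S. f differentiable at x) \<and>
     (\<forall>v. higher_differentiable_on S (\<lambda>x. frechet_derivative f (at x) v) n)"

definition smooth_on :: "'a::real_normed_vector set \<Rightarrow> ('a \<Rightarrow> 'b::real_normed_vector) \<Rightarrow> bool" where
  "smooth_on S f \<longleftrightarrow> open S \<and> (\<forall>n. higher_differentiable_on S f n)"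

definition partial_deriv :: "'n::finite \<Rightarrow> (real^'n \<Rightarrow> 'b::real_normed_vector) \<Rightarrow> real^'n \<Rightarrow> 'b" where
  "partial_deriv i f x = frechet_derivative f (at x) (axis i 1)"


section \<open>Riemannian metrics in coordinates\<close>

text \<open>
  A metric on an open subset of \<open>\<real>\<^sup>n\<close> is represented by its coefficient matrix \<open>G x\<close> at each
  point \<open>x\<close>, in the standard coordinates.
\<close>

type_synonym 'n metric = "real^'n \<Rightarrow> real^'n^'n"

definition metric_inner :: "'n::finite metric \<Rightarrow> real^'n \<Rightarrow> real^'n \<Rightarrow> real^'n \<Rightarrow> real" where
  "metric_inner G x u v = u \<bullet> (G x *v v)"

definition metric_norm :: "'n::finite metric \<Rightarrow> real^'n \<Rightarrow> real^'n \<Rightarrow> real" where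
  "metric_norm G x v = sqrt (metric_inner G x v v)"

definition riemannian_metric_on :: "(real^'n) set \<Rightarrow> 'n::finite metric \<Rightarrow> bool" where
  "riemannian_metric_on M G \<longleftrightarrow>
     open M \<and>
     (\<forall>i j. smooth_on M (\<lambda>x. G x $ i $ j)) \<and>
     (\<forall>x\<in>M. transpose (G x) = G x) \<and>
     (\<forall>x\<in>M. \<forall>v. v \<noteq> 0 \<longrightarrow> 0 < metric_inner G x v v)"

definition metric_grad :: "'n::finite metric \<Rightarrow> (real^'n \<Rightarrow> real) \<Rightarrow> real^'n \<Rightarrow> real^'n" where
  "metric_grad G f x = (THE w. \<forall>v. metric_inner G x w v = frechet_derivative f (at x) v)"

definition level_set :: "(real^'n) set \<Rightarrow> (real^'n \<Rightarrow> real) \<Rightarrow> real \<Rightarrow> (real^'n) set" where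
  "level_set M f c = {x \<in> M. f x = c}"

definition geodesically_parallel_levels ::
  "'n::finite metric \<Rightarrow> (real^'n) set \<Rightarrow> (real^'n \<Rightarrow> real) \<Rightarrow> bool" where
  "geodesically_parallel_levels G M f \<longleftrightarrow>
     riemannian_metric_on M G \<and>
     (\<forall>x\<in>M. f differentiable at x) \<and>
     (\<forall>c\<in>f ` M. \<exists>k. k \<noteq> 0 \<and> (\<forall>x\<in>level_set M f c. metric_norm G x (metric_grad G f x) = k))"

text \<open>
  \<open>christoffel G k i j x\<close> is \<open>\<Gamma>\<^sup>k\<^sub>i\<^sub>j(x) = 1/2 \<Sum>\<^sub>m g\<^sup>k\<^sup>m (\<partial>\<^sub>i g\<^sub>j\<^sub>m + \<partial>\<^sub>j g\<^sub>i\<^sub>m - \<partial>\<^sub>m g\<^sub>i\<^sub>j)\<close>.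
\<close>

definition christoffel :: "'n::finite metric \<Rightarrow> 'n \<Rightarrow> 'n \<Rightarrow> 'n \<Rightarrow> real^'n \<Rightarrow> real" where
  "christoffel G k i j x =
     (\<Sum>m\<in>UNIV. matrix_inv (G x) $ k $ m *
        (partial_deriv i (\<lambda>y. G y $ j $ m) x
         + partial_deriv j (\<lambda>y. G y $ i $ m) x
         - partial_deriv m (\<lambda>y. G y $ i $ j) x)) / 2"

text \<open>
  \<open>riemann_curv G l k i j x\<close> is the \<open>\<partial>\<^sub>l\<close>-component of \<open>R(\<partial>\<^sub>i, \<partial>\<^sub>j) \<partial>\<^sub>k\<close>, where
  \<open>R(X,Y)Z = \<nabla>\<^sub>X \<nabla>\<^sub>Y Z - \<nabla>\<^sub>Y \<nabla>\<^sub>X Z - \<nabla>\<^sub>[\<^sub>X\<^sub>,\<^sub>Y\<^sub>] Z\<close>.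
\<close>

definition riemann_curv :: "'n::finite metric \<Rightarrow> 'n \<Rightarrow> 'n \<Rightarrow> 'n \<Rightarrow> 'n \<Rightarrow> real^'n \<Rightarrow> real" where
  "riemann_curv G l k i j x =
     partial_deriv i (christoffel G l j k) x - partial_deriv j (christoffel G l i k) x
     + (\<Sum>m\<in>UNIV. christoffel G l i m x * christoffel G m j k x
                  - christoffel G l j m x * christoffel G m i k x)"

text \<open>
  Gaussian curvature \<open>g(R(\<partial>\<^sub>1,\<partial>\<^sub>2)\<partial>\<^sub>2, \<partial>\<^sub>1) / (g\<^sub>1\<^sub>1 g\<^sub>2\<^sub>2 - g\<^sub>1\<^sub>2\<^sup>2)\<close> of a metric in two variables;
  it is positive for the round sphere.
\<close>

definition gaussian_curvature :: "2 metric \<Rightarrow> real^2 \<Rightarrow> real" where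
  "gaussian_curvature G u =
     (\<Sum>l\<in>UNIV. G u $ 1 $ l * riemann_curv G l 2 1 2 u) / det (G u)"


section \<open>Surfaces in a Riemannian manifold\<close>

text \<open>Smooth regular parametrizations of relatively open pieces of an embedded surface \<open>S\<close>.\<close>

definition local_parametrization ::
  "(real^'n) set \<Rightarrow> (real^2) set \<Rightarrow> (real^2 \<Rightarrow> real^'n::finite) \<Rightarrow> bool" where
  "local_parametrization S V \<phi> \<longleftrightarrow>
     smooth_on V \<phi> \<and>
     (\<forall>u\<in>V. inj (frechet_derivative \<phi> (at u))) \<and>
     openin (top_of_set S) (\<phi> ` V) \<and>
     (\<exists>\<psi>. homeomorphism V (\<phi> ` V) \<phi> \<psi>)"

definition regular_surface :: "(real^'n::finite) set \<Rightarrow> bool" where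
  "regular_surface S \<longleftrightarrow> (\<forall>p\<in>S. \<exists>V \<phi>. local_parametrization S V \<phi> \<and> p \<in> \<phi> ` V)"

definition induced_metric :: "'n::finite metric \<Rightarrow> (real^2 \<Rightarrow> real^'n) \<Rightarrow> 2 metric" where
  "induced_metric G \<phi> u =
     (\<chi> i j. metric_inner G (\<phi> u) (partial_deriv i \<phi> u) (partial_deriv j \<phi> u))"

text \<open>
  The Gaussian and mean curvatures of a surface are expressed in every local parametrization
  around the point, so that no choice is involved; regularity of the surface guarantees that
  there is such a parametrization. The Gaussian curvature is the intrinsic curvature of the
  induced metric.
\<close>

definition has_gaussian_curvature ::
  "'n::finite metric \<Rightarrow> (real^'n) set \<Rightarrow> real^'n \<Rightarrow> real \<Rightarrow> bool" where
  "has_gaussian_curvature G S p K \<longleftrightarrow>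
     regular_surface S \<and> p \<in> S \<and>
     (\<forall>V \<phi> u. local_parametrization S V \<phi> \<longrightarrow> u \<in> V \<longrightarrow> \<phi> u = p \<longrightarrow>
        gaussian_curvature (induced_metric G \<phi>) u = K)"

text \<open>
  \<open>cov_deriv_param G \<phi> i j u\<close> is \<open>\<nabla>\<^bsub>\<partial>\<^sub>i\<phi>\<^esub> \<partial>\<^sub>j\<phi>\<close> at \<open>u\<close>, with \<open>\<nabla>\<close> the Levi-Civita connection of
  the ambient metric \<open>G\<close>.
\<close>

definition cov_deriv_param ::
  "3 metric \<Rightarrow> (real^2 \<Rightarrow> real^3) \<Rightarrow> 2 \<Rightarrow> 2 \<Rightarrow> real^2 \<Rightarrow> real^3" where
  "cov_deriv_param G \<phi> i j u =
     partial_deriv i (partial_deriv j \<phi>) u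
     + (\<chi> k. \<Sum>a\<in>UNIV. \<Sum>b\<in>UNIV. christoffel G k a b (\<phi> u)
                 * partial_deriv i \<phi> u $ a * partial_deriv j \<phi> u $ b)"

definition second_fundamental_form ::
  "3 metric \<Rightarrow> (real^2 \<Rightarrow> real^3) \<Rightarrow> real^3 \<Rightarrow> real^2 \<Rightarrow> real^2^2" where
  "second_fundamental_form G \<phi> n u =
     (\<chi> i j. metric_inner G (\<phi> u) (cov_deriv_param G \<phi> i j u) n)"

text \<open>
  Half the trace of the second fundamental form \<open>h\<close> with respect to the induced metric, that is,
  \<open>1/2 \<Sum>\<^sub>i\<^sub>j g\<^sup>i\<^sup>j h\<^sub>i\<^sub>j\<close>, for the choice \<open>n\<close> of unit normal vector at the point.
\<close>

definition mean_curvature_param ::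
  "3 metric \<Rightarrow> (real^2 \<Rightarrow> real^3) \<Rightarrow> real^3 \<Rightarrow> real^2 \<Rightarrow> real" where
  "mean_curvature_param G \<phi> n u =
     trace (matrix_inv (induced_metric G \<phi> u) ** second_fundamental_form G \<phi> n u) / 2"

definition has_mean_curvature ::
  "3 metric \<Rightarrow> (real^3) set \<Rightarrow> real^3 \<Rightarrow> real^3 \<Rightarrow> real \<Rightarrow> bool" where
  "has_mean_curvature G S n p H \<longleftrightarrow>
     regular_surface S \<and> p \<in> S \<and>
     metric_norm G p n = 1 \<and>
     (\<forall>V \<phi> u. local_parametrization S V \<phi> \<longrightarrow> u \<in> V \<longrightarrow> \<phi> u = p \<longrightarrow>
        (\<forall>i. metric_inner G p n (partial_deriv i \<phi> u) = 0) \<and>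
        mean_curvature_param G \<phi> n u = H)"

definition constant_mean_curvature ::
  "3 metric \<Rightarrow> (real^3) set \<Rightarrow> (real^3 \<Rightarrow> real^3) \<Rightarrow> bool" where
  "constant_mean_curvature G S \<nu> \<longleftrightarrow>
     continuous_on S \<nu> \<and> (\<exists>H. \<forall>p\<in>S. has_mean_curvature G S (\<nu> p) p H)"

definition unit_grad :: "'n::finite metric \<Rightarrow> (real^'n \<Rightarrow> real) \<Rightarrow> real^'n \<Rightarrow> real^'n" where
  "unit_grad G f x = metric_grad G f x /\<^sub>R metric_norm G x (metric_grad G f x)"


section \<open>Diagonal metrics depending on a linear function\<close>

definition linear_fn :: "real^3 \<Rightarrow> real^3 \<Rightarrow> real" where
  "linear_fn \<alpha> x = (\<Sum>s\<in>UNIV. \<alpha> $ s * x $ s)"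

definition slab :: "real^3 \<Rightarrow> real \<Rightarrow> real \<Rightarrow> (real^3) set" where
  "slab \<alpha> \<xi>1 \<xi>2 = {x. \<xi>1 < linear_fn \<alpha> x \<and> linear_fn \<alpha> x < \<xi>2}"

definition slab_metric :: "real^3 \<Rightarrow> (3 \<Rightarrow> real \<Rightarrow> real) \<Rightarrow> 3 metric" where
  "slab_metric \<alpha> l x = (\<chi> i j. if i = j then (l i (linear_fn \<alpha> x))\<^sup>2 else 0)"

subsection \<open>Well-definedness: the diagonal metric is Riemannian\<close>

lemma higher_differentiable_on_cong:
  assumes "open S" "\<And>x. x \<in> S \<Longrightarrow> f x = g x"
  shows "higher_differentiable_on S f n \<longleftrightarrow> higher_differentiable_on S g n"
  using assms(2)
proof (induction n arbitrary: f g)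
  case 0
  then show ?case by (simp cong: continuous_on_cong)
next
  case (Suc n)
  have hd: "(f has_derivative D) (at x) \<longleftrightarrow> (g has_derivative D) (at x)" if "x \<in> S" for x D
    using that Suc.prems has_derivative_transform_within_open[OF _ assms(1)] by metis
  have "f differentiable at x \<longleftrightarrow> g differentiable at x" if "x \<in> S" for x
    using hd[OF that] by (simp add: differentiable_def)
  moreover have "frechet_derivative f (at x) = frechet_derivative g (at x)" if "x \<in> S" for x
    using hd[OF that] by (simp add: frechet_derivative_def)
  ultimately show ?case
    using Suc.IH[of "\<lambda>x. frechet_derivative f (at x) v" "\<lambda>x. frechet_derivative g (at x) v" for v]
    by simp
qed

lemma higher_differentiable_on_SucD:
  assumes "higher_differentiable_on S f (Suc n)"
  shows "higher_differentiable_on S f n"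
  using assms
proof (induction n arbitrary: f)
  case 0
  then show ?case
    by (auto intro!: continuous_at_imp_continuous_on differentiable_imp_continuous_within)
next
  case (Suc n)
  then show ?case
    by (metis higher_differentiable_on.simps(2))
qed

lemma higher_differentiable_on_const: "higher_differentiable_on S (\<lambda>x. c) n"
  by (induction n arbitrary: c) (auto simp: frechet_derivative_const)

lemma higher_differentiable_on_add:
  assumes "open S" "higher_differentiable_on S f n" "higher_differentiable_on S g n"
  shows "higher_differentiable_on S (\<lambda>x. f x + g x) n"
  using assms(2,3)
proof (induction n arbitrary: f g)
  case 0
  then show ?case by (simp add: continuous_on_add)
next
  case (Suc n)
  have D: "frechet_derivative (\<lambda>x. f x + g x) (at x) v
      = frechet_derivative f (at x) v + frechet_derivative g (at x) v" if "x \<in> S" for x v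
  proof -
    have "(f has_derivative frechet_derivative f (at x)) (at x)"
      "(g has_derivative frechet_derivative g (at x)) (at x)"
      using Suc.prems that by (auto intro!: iffD1[OF frechet_derivative_works])
    from frechet_derivative_at[OF has_derivative_add[OF this]] show ?thesis
      by (metis (no_types, lifting))
  qed
  have "higher_differentiable_on S (\<lambda>x. frechet_derivative (\<lambda>x. f x + g x) (at x) v) n" for v
    using higher_differentiable_on_cong[of S "\<lambda>x. frechet_derivative (\<lambda>x. f x + g x) (at x) v"
        "\<lambda>x. frechet_derivative f (at x) v + frechet_derivative g (at x) v" n] assms(1) D
      Suc.IH[of "\<lambda>x. frechet_derivative f (at x) v" "\<lambda>x. frechet_derivative g (at x) v"]
      Suc.prems by simp
  then show ?case using Suc.prems by auto
qed

lemma higher_differentiable_on_mult: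
  fixes f g :: "'a::real_normed_vector \<Rightarrow> real"
  assumes "open S" "higher_differentiable_on S f n" "higher_differentiable_on S g n"
  shows "higher_differentiable_on S (\<lambda>x. f x * g x) n"
  using assms(2,3)
proof (induction n arbitrary: f g)
  case 0
  then show ?case by (simp add: continuous_on_mult)
next
  case (Suc n)
  have D: "frechet_derivative (\<lambda>x. f x * g x) (at x) v
      = f x * frechet_derivative g (at x) v + frechet_derivative f (at x) v * g x"
    if "x \<in> S" for x v
  proof -
    have "(f has_derivative frechet_derivative f (at x)) (at x)"
      "(g has_derivative frechet_derivative g (at x)) (at x)"
      using Suc.prems that by (auto intro!: iffD1[OF frechet_derivative_works])
    from frechet_derivative_at[OF has_derivative_mult[OF this]] show ?thesis
      by (metis (no_types, lifting))
  qed
  have "higher_differentiable_on S (\<lambda>x. f x * frechet_derivative g (at x) v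
      + frechet_derivative f (at x) v * g x) n" for v
  proof (rule higher_differentiable_on_add[OF assms(1)])
    have "higher_differentiable_on S f n" "higher_differentiable_on S g n"
      using Suc.prems by (blast intro: higher_differentiable_on_SucD)+
    moreover have "higher_differentiable_on S (\<lambda>x. frechet_derivative f (at x) v) n"
      "higher_differentiable_on S (\<lambda>x. frechet_derivative g (at x) v) n"
      using Suc.prems by simp_all
    ultimately show "higher_differentiable_on S (\<lambda>x. f x * frechet_derivative g (at x) v) n"
      "higher_differentiable_on S (\<lambda>x. frechet_derivative f (at x) v * g x) n"
      using Suc.IH[of f "\<lambda>x. frechet_derivative g (at x) v"]
        Suc.IH[of "\<lambda>x. frechet_derivative f (at x) v" g] by blast+
  qed
  then have "higher_differentiable_on S (\<lambda>x. frechet_derivative (\<lambda>x. f x * g x) (at x) v) n" for v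
    using higher_differentiable_on_cong[of S "\<lambda>x. frechet_derivative (\<lambda>x. f x * g x) (at x) v"
        "\<lambda>x. f x * frechet_derivative g (at x) v + frechet_derivative f (at x) v * g x" n]
      assms(1) D by simp
  then show ?case using Suc.prems by auto
qed

lemma higher_differentiable_on_compose_linear:
  fixes h :: "real \<Rightarrow> real"
  assumes "open S" "bounded_linear f" "f ` S \<subseteq> I" "higher_differentiable_on I h n"
  shows "higher_differentiable_on S (\<lambda>x. h (f x)) n"
  using assms(4)
proof (induction n arbitrary: h)
  case 0
  then show ?case
    using assms continuous_on_compose2 linear_continuous_on by (metis higher_differentiable_on.simps(1))
next
  case (Suc n)
  have hd: "((\<lambda>x. h (f x)) has_derivative (\<lambda>v. frechet_derivative h (at (f x)) (f v))) (at x)"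
    if "x \<in> S" for x
  proof -
    have "(h has_derivative frechet_derivative h (at (f x))) (at (f x))"
      using Suc.prems that assms(3) frechet_derivative_works by auto
    then show ?thesis
      using has_derivative_compose[OF bounded_linear_imp_has_derivative[OF assms(2)]] by blast
  qed
  have D: "frechet_derivative (\<lambda>x. h (f x)) (at x) v = frechet_derivative h (at (f x)) (f v)"
    if "x \<in> S" for x v
    using frechet_derivative_at[OF hd[OF that]] by metis
  have "higher_differentiable_on S (\<lambda>x. frechet_derivative h (at (f x)) (f v)) n" for v
    using Suc.IH[of "\<lambda>y. frechet_derivative h (at y) (f v)"] Suc.prems by simp
  then have "higher_differentiable_on S (\<lambda>x. frechet_derivative (\<lambda>x. h (f x)) (at x) v) n" for v
    using higher_differentiable_on_cong[of S "\<lambda>x. frechet_derivative (\<lambda>x. h (f x)) (at x) v"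
        "\<lambda>x. frechet_derivative h (at (f x)) (f v)" n] assms(1) D by simp
  moreover have "(\<lambda>x. h (f x)) differentiable at x" if "x \<in> S" for x
    using hd[OF that] by (auto simp: differentiable_def)
  ultimately show ?case by simp
qed

lemma linear_fn_eq_inner: "linear_fn \<alpha> x = \<alpha> \<bullet> x"
  by (simp add: linear_fn_def inner_vec_def)

lemma bounded_linear_linear_fn: "bounded_linear (linear_fn \<alpha>)"
  using bounded_linear_inner_right[of \<alpha>] by (simp add: linear_fn_eq_inner[abs_def])

lemma open_slab: "open (slab \<alpha> \<xi>1 \<xi>2)"
  unfolding slab_def linear_fn_eq_inner
  by (intro open_Collect_conj open_Collect_less continuous_intros)

lemma riemannian_metric_on_slab:
  assumes "\<And>s. smooth_on {\<xi>1<..<\<xi>2} (l s)"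
    and pos: "\<And>s \<xi>. \<xi> \<in> {\<xi>1<..<\<xi>2} \<Longrightarrow> 0 < l s \<xi>"
  shows "riemannian_metric_on (slab \<alpha> \<xi>1 \<xi>2) (slab_metric \<alpha> l)"
  unfolding riemannian_metric_on_def
proof (intro conjI allI ballI impI)
  let ?U = "slab \<alpha> \<xi>1 \<xi>2"
  show "open ?U" by (rule open_slab)
  show "smooth_on ?U (\<lambda>x. slab_metric \<alpha> l x $ i $ j)" for i j
  proof (cases "i = j")
    case True
    have "higher_differentiable_on ?U (\<lambda>x. l i (linear_fn \<alpha> x)) n" for n
      by (rule higher_differentiable_on_compose_linear[OF open_slab bounded_linear_linear_fn,
            where I = "{\<xi>1<..<\<xi>2}"])
        (use assms(1) in \<open>auto simp: slab_def smooth_on_def\<close>)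
    then show ?thesis
      using True
      by (simp add: slab_metric_def smooth_on_def open_slab power2_eq_square
          higher_differentiable_on_mult)
  next
    case False
    then show ?thesis
      by (simp add: slab_metric_def smooth_on_def open_slab higher_differentiable_on_const)
  qed
  show "transpose (slab_metric \<alpha> l x) = slab_metric \<alpha> l x" for x
    by (simp add: transpose_def slab_metric_def vec_eq_iff)
  show "0 < metric_inner (slab_metric \<alpha> l) x v v" if x: "x \<in> ?U" and v: "v \<noteq> 0" for x v
  proof -
    have eq: "metric_inner (slab_metric \<alpha> l) x v v = (\<Sum>s\<in>UNIV. (l s (linear_fn \<alpha> x) * v $ s)\<^sup>2)"
    proof -
      have "(slab_metric \<alpha> l x *v v) $ s = (l s (linear_fn \<alpha> x))\<^sup>2 * v $ s" for s
      proof -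
        have "slab_metric \<alpha> l x $ s $ j * v $ j
            = (if s = j then (l s (linear_fn \<alpha> x))\<^sup>2 * v $ j else 0)" for j
          by (simp add: slab_metric_def)
        then show ?thesis by (simp add: matrix_vector_mult_def)
      qed
      then show ?thesis
        by (simp add: metric_inner_def inner_vec_def power2_eq_square mult_ac)
    qed
    obtain s where "v $ s \<noteq> 0" using v by (auto simp: vec_eq_iff)
    moreover have "0 < l s (linear_fn \<alpha> x)" using x pos by (simp add: slab_def)
    ultimately have "0 < (l s (linear_fn \<alpha> x) * v $ s)\<^sup>2" by simp
    then show ?thesis unfolding eq by (intro sum_pos2[of _ s]) auto
  qed
qed

end

theory Submission
  imports Defs
begin

text \<open>
  On a level plane the metric is a constant matrix, so its gradient, its unit normal and, since the
  metric is invariant under translations along the plane, its Christoffel symbols are constant too.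
  A parametrization of a piece of the plane has tangential second derivatives. Hence
  \<open>\<partial>\<^sub>i\<partial>\<^sub>j\<phi> = \<Sum>\<^sub>k \<Gamma>\<^sup>k\<^sub>i\<^sub>j \<partial>\<^sub>k\<phi>\<close>
  with the intrinsic Christoffel symbols, and the curvature vanishes because third derivatives of
  \<open>\<phi>\<close> commute. The second fundamental form is the restriction of a constant
  bilinear form, whose trace does not depend on the frame.
\<close>

section \<open>Second derivatives commute\<close>

text \<open>Pairing with a fixed vector is bounded linear and commutes with differentiation. This
  passes from vector-valued maps to real-valued ones, where the mean value theorem applies.\<close>

lemma higher_differentiable_on_inner:
  fixes f :: "'a::real_normed_vector \<Rightarrow> 'b::real_inner"
  assumes "open S" "higher_differentiable_on S f n"
  shows "higher_differentiable_on S (\<lambda>x. f x \<bullet> b) n"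
  using assms(2)
proof (induction n arbitrary: f)
  case 0
  then show ?case by (auto intro: continuous_intros)
next
  case (Suc n)
  have hd: "((\<lambda>x. f x \<bullet> b) has_derivative (\<lambda>v. frechet_derivative f (at x) v \<bullet> b)) (at x)"
    if "x \<in> S" for x
    using Suc.prems that
    by (intro has_derivative_inner_left) (simp add: frechet_derivative_works[symmetric])
  have "frechet_derivative (\<lambda>x. f x \<bullet> b) (at x) v = frechet_derivative f (at x) v \<bullet> b"
    if "x \<in> S" for x v
    using frechet_derivative_at[OF hd[OF that]] by metis
  moreover have "higher_differentiable_on S (\<lambda>x. frechet_derivative f (at x) v \<bullet> b) n" for v
    using Suc.IH[of "\<lambda>x. frechet_derivative f (at x) v"] Suc.prems by simp
  ultimately have "higher_differentiable_on S (\<lambda>x. frechet_derivative (\<lambda>x. f x \<bullet> b) (at x) v) n" for v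
    using higher_differentiable_on_cong[of S "\<lambda>x. frechet_derivative (\<lambda>x. f x \<bullet> b) (at x) v"
        "\<lambda>x. frechet_derivative f (at x) v \<bullet> b" n] assms(1) by simp
  moreover have "(\<lambda>x. f x \<bullet> b) differentiable at x" if "x \<in> S" for x
    using hd[OF that] by (auto simp: differentiable_def)
  ultimately show ?case by simp
qed

lemma has_real_derivative_along_line:
  fixes f :: "'a::real_normed_vector \<Rightarrow> real"
  assumes "f differentiable at (x + t *\<^sub>R v)"
  shows "((\<lambda>t. f (x + t *\<^sub>R v)) has_real_derivative frechet_derivative f (at (x + t *\<^sub>R v)) v) (at t)"
proof -
  let ?D = "frechet_derivative f (at (x + t *\<^sub>R v))"
  have D: "(f has_derivative ?D) (at (x + t *\<^sub>R v))"
    using assms frechet_derivative_works by blast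
  have "((\<lambda>t. x + t *\<^sub>R v) has_derivative (\<lambda>h. h *\<^sub>R v)) (at t)"
    by (auto intro!: derivative_eq_intros)
  from has_derivative_compose[OF this D]
  have "((\<lambda>t. f (x + t *\<^sub>R v)) has_derivative (\<lambda>h. ?D (h *\<^sub>R v))) (at t)" .
  moreover have "?D (h *\<^sub>R v) = ?D v * h" for h
    using linear_scale[OF has_derivative_linear[OF D]] by simp
  ultimately show ?thesis
    by (simp add: has_field_derivative_def)
qed

text \<open>Mean value theorem twice, first in direction \<open>v\<close>, then in direction
  \<open>w\<close>. The second difference is symmetric in \<open>v\<close> and \<open>w\<close>,
  which is what forces mixed derivatives to agree.\<close>

lemma second_difference_eq_mixed_derivative:
  fixes f :: "'a::real_normed_vector \<Rightarrow> real"
  assumes f: "higher_differentiable_on S f 2" and S: "ball u r \<subseteq> S"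
    and s: "0 < s" "s * (norm v + norm w) < r"
  obtains p where "p \<in> ball u r"
    "f (u + s *\<^sub>R v + s *\<^sub>R w) - f (u + s *\<^sub>R v) - f (u + s *\<^sub>R w) + f u
      = s\<^sup>2 * frechet_derivative (\<lambda>x. frechet_derivative f (at x) v) (at p) w"
proof -
  let ?fv = "\<lambda>x. frechet_derivative f (at x) v"
  have df: "f differentiable at x" "?fv differentiable at x" if "x \<in> ball u r" for x
    using f S that by (auto simp: numeral_2_eq_2)
  have inb: "u + a *\<^sub>R v + b *\<^sub>R w \<in> ball u r" if "0 \<le> a" "a \<le> s" "0 \<le> b" "b \<le> s" for a b
  proof -
    have "norm (a *\<^sub>R v + b *\<^sub>R w) \<le> a * norm v + b * norm w"
      using norm_triangle_ineq[of "a *\<^sub>R v" "b *\<^sub>R w"] that by simp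
    also have "\<dots> \<le> s * norm v + s * norm w"
      using that by (intro add_mono mult_right_mono) auto
    also have "\<dots> < r" using s by (simp add: algebra_simps)
    finally have "norm (- (a *\<^sub>R v + b *\<^sub>R w)) < r" unfolding norm_minus_cancel .
    then show ?thesis by (simp add: dist_norm algebra_simps)
  qed
  \<comment> \<open>Compares \<open>f\<close> on two parallel segments in direction
    \<open>v\<close>, a distance \<open>s *\<^sub>R w\<close> apart, so that
    \<open>?g s - ?g 0\<close> is the second difference.\<close>
  let ?g = "\<lambda>t. f (u + s *\<^sub>R w + t *\<^sub>R v) - f (u + t *\<^sub>R v)"
  have "(?g has_real_derivative ?fv (u + s *\<^sub>R w + t *\<^sub>R v) - ?fv (u + t *\<^sub>R v)) (at t)"
    if "0 \<le> t" "t \<le> s" for t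
    using inb[of t s] inb[of t 0] that s
    by (intro DERIV_diff has_real_derivative_along_line df) (auto simp: ac_simps)
  from MVT2[OF s(1) this] obtain z where z: "0 < z" "z < s"
    and gz: "?g s - ?g 0 = s * (?fv (u + s *\<^sub>R w + z *\<^sub>R v) - ?fv (u + z *\<^sub>R v))"
    by auto
  have "((\<lambda>t. ?fv (u + z *\<^sub>R v + t *\<^sub>R w)) has_real_derivative
      frechet_derivative ?fv (at (u + z *\<^sub>R v + t *\<^sub>R w)) w) (at t)" if "0 \<le> t" "t \<le> s" for t
    using inb[of z t] that z by (intro has_real_derivative_along_line df) auto
  from MVT2[OF s(1) this] obtain y where y: "0 < y" "y < s"
    and hy: "?fv (u + z *\<^sub>R v + s *\<^sub>R w) - ?fv (u + z *\<^sub>R v)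
      = s * frechet_derivative ?fv (at (u + z *\<^sub>R v + y *\<^sub>R w)) w"
    by auto
  show thesis
  proof
    show "u + z *\<^sub>R v + y *\<^sub>R w \<in> ball u r" using inb y z by simp
    show "f (u + s *\<^sub>R v + s *\<^sub>R w) - f (u + s *\<^sub>R v) - f (u + s *\<^sub>R w) + f u
      = s\<^sup>2 * frechet_derivative ?fv (at (u + z *\<^sub>R v + y *\<^sub>R w)) w"
      using gz hy by (simp add: ac_simps power2_eq_square)
  qed
qed

text \<open>Schwarz's theorem. The second difference over a small parallelogram is
  \<open>s\<^sup>2\<close> times either mixed derivative, each at some nearby point, and both mixed
  derivatives are continuous.\<close>

lemma second_derivative_commute_real:
  fixes f :: "'a::real_normed_vector \<Rightarrow> real"
  assumes S: "open S" and f: "higher_differentiable_on S f 2" and u: "u \<in> S"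
  shows "frechet_derivative (\<lambda>x. frechet_derivative f (at x) v) (at u) w
    = frechet_derivative (\<lambda>x. frechet_derivative f (at x) w) (at u) v"
proof (rule ccontr)
  let ?F = "\<lambda>v w x. frechet_derivative (\<lambda>x. frechet_derivative f (at x) v) (at x) w"
  assume neq: "?F v w u \<noteq> ?F w v u"
  \<comment> \<open>Half the supposed gap: two numbers strictly within \<open>e\<close> of the
    respective values at \<open>u\<close> cannot coincide.\<close>
  define e where "e = \<bar>?F v w u - ?F w v u\<bar> / 2"
  have e: "0 < e" using neq by (simp add: e_def)
  have near: "\<exists>r>0. ball u r \<subseteq> S \<and> (\<forall>x\<in>ball u r. \<bar>?F v w x - ?F v w u\<bar> < e)" for v w
  proof -
    have "continuous_on S (?F v w)" using f by (simp add: numeral_2_eq_2)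
    then have "isCont (?F v w) u" using S u by (simp add: continuous_on_eq_continuous_at)
    then obtain d where "0 < d" "\<And>x. dist x u < d \<Longrightarrow> \<bar>?F v w x - ?F v w u\<bar> < e"
      using e unfolding continuous_at_eps_delta by (auto simp: dist_real_def)
    moreover obtain r where "0 < r" "ball u r \<subseteq> S" using S u open_contains_ball by blast
    ultimately show ?thesis
      by (intro exI[of _ "min d r"]) (auto simp: dist_commute)
  qed
  obtain r1 where r1: "0 < r1" "ball u r1 \<subseteq> S" "\<forall>x\<in>ball u r1. \<bar>?F v w x - ?F v w u\<bar> < e"
    using near by blast
  obtain r2 where r2: "0 < r2" "ball u r2 \<subseteq> S" "\<forall>x\<in>ball u r2. \<bar>?F w v x - ?F w v u\<bar> < e"
    using near by blast
  define r where "r = min r1 r2"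
  \<comment> \<open>The summand 1 keeps the denominator positive when both directions vanish;
    \<open>s\<close> is small enough to keep the parallelogram inside
    \<open>ball u r\<close>.\<close>
  define s where "s = r / (2 * (norm v + norm w + 1))"
  have "0 < r" using r1 r2 by (simp add: r_def)
  moreover have n: "0 < norm v + norm w + 1" by (simp add: add_nonneg_pos)
  ultimately have s: "0 < s" by (simp add: s_def)
  have "s * (norm v + norm w) < s * (2 * (norm v + norm w + 1))"
    using s n by (intro mult_strict_left_mono) auto
  also have "\<dots> = r" using n by (simp add: s_def)
  finally have sr: "s * (norm v + norm w) < r" .
  have br: "ball u r \<subseteq> S" using r1(2) by (auto simp: r_def)
  obtain p where p: "p \<in> ball u r"
    "f (u + s *\<^sub>R v + s *\<^sub>R w) - f (u + s *\<^sub>R v) - f (u + s *\<^sub>R w) + f u = s\<^sup>2 * ?F v w p"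
    using second_difference_eq_mixed_derivative[OF f br s sr] by blast
  have "s * (norm w + norm v) < r" using sr by (simp add: add.commute)
  then obtain q where q: "q \<in> ball u r"
    "f (u + s *\<^sub>R w + s *\<^sub>R v) - f (u + s *\<^sub>R w) - f (u + s *\<^sub>R v) + f u = s\<^sup>2 * ?F w v q"
    using second_difference_eq_mixed_derivative[OF f br s] by blast
  have "s\<^sup>2 * ?F v w p = s\<^sup>2 * ?F w v q"
    using p(2) q(2) by (simp add: algebra_simps)
  then have "?F v w p = ?F w v q" using s by simp
  moreover have "\<bar>?F v w p - ?F v w u\<bar> < e" "\<bar>?F w v q - ?F w v u\<bar> < e"
    using p(1) q(1) r1(3) r2(3) by (auto simp: r_def)
  ultimately show False
    unfolding e_def by (simp add: abs_if field_simps split: if_splits)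
qed

lemma higher_differentiable_onD:
  assumes "higher_differentiable_on S f (Suc n)" "x \<in> S"
  shows "(f has_derivative frechet_derivative f (at x)) (at x)"
  using assms by (simp add: frechet_derivative_works[symmetric])

text \<open>A vector is determined by its inner products with all \<open>b\<close>, so the real case
  suffices.\<close>

lemma second_derivative_commute:
  fixes f :: "'a::real_normed_vector \<Rightarrow> 'b::real_inner"
  assumes S: "open S" and f: "higher_differentiable_on S f 2" and u: "u \<in> S"
  shows "frechet_derivative (\<lambda>x. frechet_derivative f (at x) v) (at u) w
    = frechet_derivative (\<lambda>x. frechet_derivative f (at x) w) (at u) v"
proof (rule vector_eq_rdot[THEN iffD1], intro allI)
  fix b
  have 1: "frechet_derivative (\<lambda>x. f x \<bullet> b) (at x) v = frechet_derivative f (at x) v \<bullet> b"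
    if "x \<in> S" for x v
  proof -
    have "(f has_derivative frechet_derivative f (at x)) (at x)"
      using higher_differentiable_onD[OF f[unfolded numeral_2_eq_2] that] .
    from frechet_derivative_at[OF has_derivative_inner_left[OF this]] show ?thesis by metis
  qed
  have 2: "frechet_derivative (\<lambda>x. frechet_derivative (\<lambda>x. f x \<bullet> b) (at x) v) (at u) w
    = frechet_derivative (\<lambda>x. frechet_derivative f (at x) v) (at u) w \<bullet> b" for v w
  proof -
    have "((\<lambda>x. frechet_derivative f (at x) v) has_derivative
        frechet_derivative (\<lambda>x. frechet_derivative f (at x) v) (at u)) (at u)"
      using f u by (simp add: numeral_2_eq_2 frechet_derivative_works[symmetric])
    from has_derivative_inner_left[OF this]
    have "((\<lambda>x. frechet_derivative (\<lambda>x. f x \<bullet> b) (at x) v) has_derivative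
        (\<lambda>w. frechet_derivative (\<lambda>x. frechet_derivative f (at x) v) (at u) w \<bullet> b)) (at u)"
      by (rule has_derivative_transform_within_open[OF _ S u]) (simp add: 1)
    from frechet_derivative_at[OF this] show ?thesis by metis
  qed
  show "frechet_derivative (\<lambda>x. frechet_derivative f (at x) v) (at u) w \<bullet> b
    = frechet_derivative (\<lambda>x. frechet_derivative f (at x) w) (at u) v \<bullet> b"
    using second_derivative_commute_real[OF S higher_differentiable_on_inner[OF S f, of b] u, of v w]
    unfolding 2 .
qed

section \<open>Surfaces with tangential second derivatives in a constant metric\<close>

lemma smooth_on_partial_deriv:
  assumes "smooth_on V f"
  shows "smooth_on V (partial_deriv i f)"
  unfolding smooth_on_def
proof (intro conjI allI)
  show "open V" using assms by (simp add: smooth_on_def)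
  show "higher_differentiable_on V (partial_deriv i f) n" for n
  proof -
    have "higher_differentiable_on V f (Suc n)" using assms unfolding smooth_on_def by blast
    then show ?thesis unfolding higher_differentiable_on.simps partial_deriv_def by blast
  qed
qed

lemma smooth_on_has_derivative:
  assumes "smooth_on V f" "u \<in> V"
  shows "(f has_derivative frechet_derivative f (at u)) (at u)"
  using assms higher_differentiable_onD[of V f] unfolding smooth_on_def by blast

lemma partial_deriv_eq:
  assumes "(f has_derivative D) (at u)"
  shows "partial_deriv i f u = D (axis i 1)"
  using frechet_derivative_at[OF assms] by (simp add: partial_deriv_def)

text \<open>Holds also where \<open>f\<close> is not differentiable:
  \<open>frechet_derivative\<close> chooses among the maps satisfying \<open>has_derivative\<close>,
  and these are the same maps for \<open>f\<close> and \<open>g\<close>.\<close>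

lemma partial_deriv_cong:
  assumes "open V" "u \<in> V" "\<And>y. y \<in> V \<Longrightarrow> f y = g y"
  shows "partial_deriv i f u = partial_deriv i g u"
proof -
  have "(f has_derivative D) (at u) \<longleftrightarrow> (g has_derivative D) (at u)" for D
    using assms has_derivative_transform_within_open[OF _ assms(1,2)] by metis
  then show ?thesis by (simp add: partial_deriv_def frechet_derivative_def)
qed

lemma partial_deriv_commute:
  fixes f :: "real^'n \<Rightarrow> 'b::real_inner"
  assumes "smooth_on V f" "u \<in> V"
  shows "partial_deriv i (partial_deriv j f) u = partial_deriv j (partial_deriv i f) u"
proof -
  have "open V" "higher_differentiable_on V f 2" using assms(1) by (auto simp: smooth_on_def)
  from second_derivative_commute[OF this assms(2)] show ?thesis
    unfolding partial_deriv_def .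
qed

section \<open>Inverse matrices and Gram matrices\<close>

lemma linear_eq_sum_axis:
  fixes D :: "real^'n \<Rightarrow> 'b::real_vector"
  assumes "linear D"
  shows "D a = (\<Sum>k\<in>UNIV. a $ k *\<^sub>R D (axis k 1))"
proof -
  have "a = (\<Sum>k\<in>UNIV. a $ k *\<^sub>R axis k 1)"
    using basis_expansion[of a] by (simp add: scalar_mult_eq_scaleR)
  then have "D a = D (\<Sum>k\<in>UNIV. a $ k *\<^sub>R axis k 1)" by simp
  then show ?thesis using assms by (simp add: linear_sum linear_scale)
qed

lemma matrix_inv_inverse:
  fixes A :: "real^'n^'n"
  assumes "invertible A"
  shows "A ** matrix_inv A = mat 1" "matrix_inv A ** A = mat 1"
  using someI_ex[OF assms[unfolded invertible_def]] unfolding matrix_inv_def by auto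

text \<open>If the matrix kills \<open>a\<close>, the combination of the \<open>e k\<close> with
  coefficients \<open>a\<close> is orthogonal to every \<open>e i\<close>, hence to itself;
  positivity makes it zero, and independence gives \<open>a = 0\<close>.\<close>

lemma invertible_gram_matrix:
  fixes e :: "'m::finite \<Rightarrow> real^'n"
  assumes indep: "\<And>a. (\<Sum>k\<in>UNIV. a $ k *\<^sub>R e k) = 0 \<Longrightarrow> (a :: real^'m) = 0"
    and pos: "\<And>v. v \<noteq> 0 \<Longrightarrow> 0 < v \<bullet> (C *v v)"
  shows "invertible (\<chi> i j. e i \<bullet> (C *v e j))"
  unfolding invertible_left_inverse matrix_left_invertible_ker
proof (intro allI impI)
  fix a :: "real^'m"
  let ?w = "\<Sum>k\<in>UNIV. a $ k *\<^sub>R e k"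
  assume "(\<chi> i j. e i \<bullet> (C *v e j)) *v a = 0"
  then have "e i \<bullet> (C *v ?w) = 0" for i
    by (simp add: vec_eq_iff matrix_vector_mult_def[of "\<chi> i j. e i \<bullet> (C *v e j)"] inner_sum_right
        linear_sum[OF matrix_vector_mul_linear] matrix_vector_mult_scaleR mult.commute)
  then have "?w \<bullet> (C *v ?w) = 0" by (simp add: inner_sum_left)
  then have "?w = 0" using pos[of ?w] by fastforce
  then show "a = 0" by (rule indep)
qed

section \<open>Intrinsic geometry of the induced metric\<close>

locale totally_geodesic_in_constant_metric =
  fixes G :: "'n::finite metric" and C :: "real^'n^'n" and V :: "(real^2) set"
    and \<phi> :: "real^2 \<Rightarrow> real^'n"
  assumes smooth: "smooth_on V \<phi>"
    and inj: "\<And>u. u \<in> V \<Longrightarrow> inj (frechet_derivative \<phi> (at u))"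
    and tangential: "\<And>u i j. u \<in> V \<Longrightarrow>
      partial_deriv i (partial_deriv j \<phi>) u \<in> range (frechet_derivative \<phi> (at u))"
    and sym: "transpose C = C"
    and pos: "\<And>v. v \<noteq> 0 \<Longrightarrow> 0 < v \<bullet> (C *v v)"
    and metric_const: "\<And>u. u \<in> V \<Longrightarrow> G (\<phi> u) = C"
begin

abbreviation e :: "2 \<Rightarrow> real^2 \<Rightarrow> real^'n" where "e i \<equiv> partial_deriv i \<phi>"
abbreviation de :: "2 \<Rightarrow> 2 \<Rightarrow> real^2 \<Rightarrow> real^'n" where "de i j \<equiv> partial_deriv i (e j)"
abbreviation B :: "real^'n \<Rightarrow> real^'n \<Rightarrow> real" where "B x y \<equiv> x \<bullet> (C *v y)"
abbreviation g :: "2 metric" where "g \<equiv> induced_metric G \<phi>"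

lemma B_commute: "B x y = B y x"
  by (metis dot_lmul_matrix inner_commute sym transpose_matrix_vector)

lemma bounded_bilinear_B: "bounded_bilinear B"
  using bounded_bilinear.comp[OF bounded_bilinear_inner bounded_linear_ident matrix_vector_mul_bounded_linear] .

lemma open_V: "open V"
  using smooth by (simp add: smooth_on_def)

lemma smooth_e: "smooth_on V (e i)" and smooth_de: "smooth_on V (de i j)"
  by (intro smooth_on_partial_deriv smooth)+

text \<open>The combination is the image of \<open>a\<close> under the injective derivative of
  \<phi>.\<close>

lemma frame_independent:
  assumes "u \<in> V" "(\<Sum>k\<in>UNIV. a $ k *\<^sub>R e k u) = 0"
  shows "a = 0"
proof -
  let ?D = "frechet_derivative \<phi> (at u)"
  have lin: "linear ?D" using smooth_on_has_derivative[OF smooth assms(1)] has_derivative_linear by blast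
  have "?D a = ?D 0"
    using assms(2) linear_eq_sum_axis[OF lin, of a] linear_0[OF lin] by (simp add: partial_deriv_def)
  then show ?thesis using inj[OF assms(1)] by (simp add: inj_def)
qed

lemma induced_metric_nth: "u \<in> V \<Longrightarrow> g u $ i $ j = B (e i u) (e j u)"
  by (simp add: induced_metric_def metric_inner_def metric_const)

lemma invertible_g:
  assumes "u \<in> V"
  shows "invertible (g u)"
proof -
  have "g u = (\<chi> i j. B (e i u) (e j u))"
    by (simp add: vec_eq_iff induced_metric_nth assms)
  then show ?thesis
    using invertible_gram_matrix[OF frame_independent[OF assms] pos] by simp
qed

text \<open>Product rule: the ambient metric equals \<open>C\<close> all along the surface, so only
  the frame vectors are differentiated.\<close>

lemma partial_deriv_induced_metric:
  assumes "u \<in> V"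
  shows "partial_deriv i (\<lambda>y. g y $ j $ m) u = B (de i j u) (e m u) + B (e j u) (de i m u)"
proof -
  have "partial_deriv i (\<lambda>y. g y $ j $ m) u = partial_deriv i (\<lambda>y. B (e j y) (e m y)) u"
    by (rule partial_deriv_cong[OF open_V assms]) (simp add: induced_metric_nth)
  also have "\<dots> = B (e j u) (de i m u) + B (de i j u) (e m u)"
    using partial_deriv_eq[OF bounded_bilinear.FDERIV[OF bounded_bilinear_B
      smooth_on_has_derivative[OF smooth_e assms] smooth_on_has_derivative[OF smooth_e assms]]]
    by (simp add: partial_deriv_def[of _ "e _"])
  finally show ?thesis by simp
qed

text \<open>By symmetry of \<open>B\<close> and of \<open>de i j\<close> in \<open>i\<close> and
  \<open>j\<close>, four of the six terms given by the product rule cancel; the other two are equal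
  and absorb the factor 1/2.\<close>

lemma christoffel_induced:
  assumes "u \<in> V"
  shows "christoffel g k i j u = (matrix_inv (g u) *v (\<chi> m. B (de i j u) (e m u))) $ k"
proof -
  note c = partial_deriv_commute[OF smooth assms]
  have "partial_deriv i (\<lambda>y. g y $ j $ m) u + partial_deriv j (\<lambda>y. g y $ i $ m) u
      - partial_deriv m (\<lambda>y. g y $ i $ j) u = 2 * B (de i j u) (e m u)" for m
    unfolding partial_deriv_induced_metric[OF assms]
    using B_commute[of "e i u" "de j m u"] B_commute[of "e j u" "de i m u"]
      c[of i j] c[of j m] c[of i m] B_commute[of "e i u" "de m j u"] by simp
  then show ?thesis
    by (simp add: christoffel_def matrix_vector_mult_def sum_divide_distrib)
qed

text \<open>Tangentiality supplies some coefficients \<open>a\<close>. Pairing with the frame gives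
  \<open>g u *v a\<close>, and inverting \<open>g u\<close> identifies \<open>a\<close> with the
  Christoffel symbols.\<close>

lemma gauss_formula:
  assumes "u \<in> V"
  shows "de i j u = (\<Sum>k\<in>UNIV. christoffel g k i j u *\<^sub>R e k u)"
proof -
  let ?D = "frechet_derivative \<phi> (at u)"
  have lin: "linear ?D" using smooth_on_has_derivative[OF smooth assms(1)] has_derivative_linear by blast
  obtain a where a: "de i j u = ?D a" using tangential[OF assms] by blast
  then have exp: "de i j u = (\<Sum>k\<in>UNIV. a $ k *\<^sub>R e k u)"
    using linear_eq_sum_axis[OF lin, of a] by (simp add: partial_deriv_def[of _ \<phi>])
  have "B (de i j u) (e m u) = (g u *v a) $ m" for m
  proof -
    have "B (de i j u) (e m u) = (\<Sum>k\<in>UNIV. B (e m u) (e k u) * a $ k)"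
      unfolding exp by (simp add: inner_sum_left B_commute[of "e m u"] mult.commute)
    then show ?thesis by (simp add: matrix_vector_mult_def[of "g u"] induced_metric_nth assms)
  qed
  then have "(\<chi> m. B (de i j u) (e m u)) = g u *v a" by (simp add: vec_eq_iff)
  then have "christoffel g k i j u = a $ k" for k
    using matrix_inv_inverse(2)[OF invertible_g[OF assms]]
    by (simp add: christoffel_induced[OF assms] matrix_vector_mul_assoc)
  with exp show ?thesis by simp
qed

text \<open>Cramer's rule replaces \<open>matrix_inv\<close> by a quotient of determinants with
  smooth entries, from which differentiability can be read off.\<close>

lemma christoffel_cramer:
  assumes "u \<in> V"
  shows "christoffel g k i j u = det (\<chi> m n. if n = k then B (de i j u) (e m u) else g u $ m $ n) / det (g u)"
proof -
  let ?b = "\<chi> m. B (de i j u) (e m u)"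
  have "g u *v (matrix_inv (g u) *v ?b) = ?b"
    using matrix_inv_inverse(1)[OF invertible_g[OF assms]] by (simp add: matrix_vector_mul_assoc)
  then have "matrix_inv (g u) *v ?b =
      (\<chi> k. det (\<chi> m n. if n = k then ?b $ m else g u $ m $ n) / det (g u))"
    using cramer invertible_g[OF assms] invertible_det_nz by blast
  then show ?thesis by (simp add: christoffel_induced[OF assms] cong: if_cong)
qed

lemma christoffel_differentiable:
  assumes "u \<in> V"
  shows "christoffel g k i j differentiable at u"
proof -
  let ?g = "\<lambda>m n y. B (e m y) (e n y)"
  let ?b = "\<lambda>m y. B (de i j y) (e m y)"
  let ?entry = "\<lambda>m n y. if n = k then ?b m y else ?g m n y"
  have dB: "(\<lambda>y. B (p y) (q y)) differentiable at u" if "smooth_on V p" "smooth_on V q" for p q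
    using bounded_bilinear.FDERIV[OF bounded_bilinear_B
      smooth_on_has_derivative[OF that(1) assms] smooth_on_has_derivative[OF that(2) assms]]
    by (rule differentiableI)
  have entry: "?entry m n differentiable at u" for m n
    by (cases "n = k") (simp_all add: dB smooth_e smooth_de)
  have gd: "?g m n differentiable at u" for m n by (simp add: dB smooth_e)
  have "det (g u) \<noteq> 0" using invertible_g[OF assms] invertible_det_nz by blast
  then have nz: "?g 1 1 u * ?g 2 2 u - ?g 1 2 u * ?g 2 1 u \<noteq> 0"
    by (simp add: det_2 induced_metric_nth assms)
  \<comment> \<open>Cramer's quotient with both 2 by 2 determinants written out in terms of the
    frame; it agrees with the Christoffel symbol on all of \<open>V\<close>.\<close>
  have "(\<lambda>y. (?entry 1 1 y * ?entry 2 2 y - ?entry 1 2 y * ?entry 2 1 y) /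
      (?g 1 1 y * ?g 2 2 y - ?g 1 2 y * ?g 2 1 y)) differentiable at u" (is "?F differentiable _")
    using nz by (intro differentiable_divide differentiable_diff differentiable_mult entry gd)
  then obtain D where D: "(?F has_derivative D) (at u)" by (auto simp: differentiable_def)
  have "(christoffel g k i j has_derivative D) (at u)"
    by (rule has_derivative_transform_within_open[OF D open_V assms])
      (simp add: christoffel_cramer det_2 induced_metric_nth)
  then show ?thesis by (rule differentiableI)
qed

text \<open>Differentiating the Gauss formula and expanding the derivatives of the frame by it
  again, the antisymmetric part in \<open>i\<close> and \<open>j\<close> has the curvature
  components as coefficients. It vanishes because derivatives commute, and the frame is
  independent.\<close>

lemma riemann_curv_induced_eq_0:
  assumes "u \<in> V"
  shows "riemann_curv g l k i j u = 0"
proof -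
  let ?\<Gamma> = "christoffel g"
  have d2: "partial_deriv i (de j k) u = (\<Sum>l\<in>UNIV.
      (partial_deriv i (?\<Gamma> l j k) u + (\<Sum>m\<in>UNIV. ?\<Gamma> l i m u * ?\<Gamma> m j k u)) *\<^sub>R e l u)" for i j
  proof -
    have "partial_deriv i (de j k) u = partial_deriv i (\<lambda>y. \<Sum>l\<in>UNIV. ?\<Gamma> l j k y *\<^sub>R e l y) u"
      by (rule partial_deriv_cong[OF open_V assms]) (rule gauss_formula)
    also have "\<dots> = (\<Sum>l\<in>UNIV. ?\<Gamma> l j k u *\<^sub>R de i l u + partial_deriv i (?\<Gamma> l j k) u *\<^sub>R e l u)"
    proof -
      have "((\<lambda>y. \<Sum>l\<in>UNIV. ?\<Gamma> l j k y *\<^sub>R e l y) has_derivative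
          (\<lambda>h. \<Sum>l\<in>UNIV. ?\<Gamma> l j k u *\<^sub>R frechet_derivative (e l) (at u) h
            + frechet_derivative (?\<Gamma> l j k) (at u) h *\<^sub>R e l u)) (at u)"
        using christoffel_differentiable[OF assms]
        by (intro has_derivative_sum has_derivative_scaleR smooth_on_has_derivative[OF smooth_e assms])
          (simp add: frechet_derivative_works[symmetric])
      from partial_deriv_eq[OF this] show ?thesis by (simp add: partial_deriv_def)
    qed
    also have "\<dots> = (\<Sum>m\<in>UNIV. ?\<Gamma> m j k u *\<^sub>R (\<Sum>l\<in>UNIV. ?\<Gamma> l i m u *\<^sub>R e l u))
        + (\<Sum>l\<in>UNIV. partial_deriv i (?\<Gamma> l j k) u *\<^sub>R e l u)"
      unfolding sum.distrib gauss_formula[OF assms] ..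
    also have "(\<Sum>m\<in>UNIV. ?\<Gamma> m j k u *\<^sub>R (\<Sum>l\<in>UNIV. ?\<Gamma> l i m u *\<^sub>R e l u))
        = (\<Sum>l\<in>UNIV. (\<Sum>m\<in>UNIV. ?\<Gamma> l i m u * ?\<Gamma> m j k u) *\<^sub>R e l u)"
      unfolding scaleR_sum_right scaleR_sum_left scaleR_scaleR
      by (subst sum.swap) (simp add: mult.commute)
    finally show ?thesis by (simp add: scaleR_add_left sum.distrib add.commute)
  qed
  have "(\<Sum>l\<in>UNIV. (\<chi> l. riemann_curv g l k i j u) $ l *\<^sub>R e l u)
      = partial_deriv i (de j k) u - partial_deriv j (de i k) u"
    unfolding d2 by (simp add: riemann_curv_def sum_subtractf sum.distrib algebra_simps)
  also have "\<dots> = 0"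
    using partial_deriv_commute[OF smooth_e assms, of i j k] by simp
  finally have "(\<chi> l. riemann_curv g l k i j u) = 0"
    by (rule frame_independent[OF assms])
  then show ?thesis by (simp add: vec_eq_iff)
qed

end

section \<open>Change of basis, hyperplanes and translations\<close>

lemma matrix_inv_unique:
  fixes A B :: "real^'n^'n"
  assumes "B ** A = mat 1"
  shows "matrix_inv A = B"
proof -
  have "invertible A" using assms invertible_left_inverse by blast
  then have "B ** A ** matrix_inv A = B"
    by (simp add: matrix_mul_assoc[symmetric] matrix_inv_inverse)
  then show ?thesis by (simp add: assms)
qed

text \<open>When both forms change by congruence, \<open>matrix_inv g ** h\<close> changes by
  conjugation with \<open>A\<close>, which preserves the trace. This makes mean curvature
  independent of the frame.\<close>

lemma trace_matrix_inv_congruence: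
  fixes A g h :: "real^'n^'n"
  assumes A: "invertible A" and g: "invertible g"
  shows "trace (matrix_inv (transpose A ** g ** A) ** (transpose A ** h ** A)) = trace (matrix_inv g ** h)"
proof -
  let ?A = "matrix_inv A" and ?g = "matrix_inv g"
  have T: "transpose ?A ** transpose A = mat 1"
    using matrix_inv_inverse(1)[OF A] by (simp add: matrix_transpose_mul[symmetric] transpose_mat)
  have c: "?A ** ?g ** transpose ?A ** (transpose A ** X) = ?A ** ?g ** X" for X
  proof -
    have "?A ** ?g ** transpose ?A ** (transpose A ** X)
        = ?A ** ?g ** (transpose ?A ** transpose A) ** X" by (simp only: matrix_mul_assoc)
    then show ?thesis by (simp add: T)
  qed
  have "?A ** ?g ** transpose ?A ** (transpose A ** g ** A) = ?A ** (?g ** g) ** A"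
    using c[of "g ** A"] by (simp add: matrix_mul_assoc)
  also have "\<dots> = mat 1" using matrix_inv_inverse(2)[OF A] matrix_inv_inverse(2)[OF g] by simp
  finally have "matrix_inv (transpose A ** g ** A) = ?A ** ?g ** transpose ?A"
    by (rule matrix_inv_unique)
  then have "trace (matrix_inv (transpose A ** g ** A) ** (transpose A ** h ** A))
      = trace (?A ** (?g ** h ** A))"
    using c[of "h ** A"] by (simp add: matrix_mul_assoc)
  also have "\<dots> = trace (?g ** h ** (A ** ?A))"
    by (subst trace_mul_sym) (simp add: matrix_mul_assoc)
  finally show ?thesis using matrix_inv_inverse(1)[OF A] by simp
qed

text \<open>Column \<open>i\<close> of \<open>A\<close> holds the coordinates of \<open>e i\<close>
  in the frame \<open>L\<close>. An arbitrary bilinear form is allowed so as to cover both the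
  metric and the second fundamental form.\<close>

lemma bilinear_matrix_change_of_basis:
  fixes A :: "real^'m^'m" and L :: "'m \<Rightarrow> 'b::real_vector" and \<beta> :: "'b \<Rightarrow> 'b \<Rightarrow> real"
  assumes "bilinear \<beta>" and e: "\<And>i. e i = (\<Sum>k\<in>UNIV. A $ k $ i *\<^sub>R L k)"
  shows "(\<chi> i j. \<beta> (e i) (e j)) = transpose A ** (\<chi> i j. \<beta> (L i) (L j)) ** A"
proof -
  have lin: "linear (\<lambda>x. \<beta> x y)" "linear (\<beta> x)" for x y
    using assms(1) by (auto simp: bilinear_def)
  have "\<beta> (e i) (e j) = (\<Sum>m\<in>UNIV. (\<Sum>k\<in>UNIV. A $ k $ i * \<beta> (L k) (L m)) * A $ m $ j)" for i j
    unfolding e by (simp add: linear_sum[OF lin(1)] linear_sum[OF lin(2)] linear_scale[OF lin(1)]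
        linear_scale[OF lin(2)] sum_distrib_left sum_distrib_right mult_ac)
  then show ?thesis by (simp add: vec_eq_iff matrix_matrix_mult_def transpose_def)
qed

section \<open>Maps into hyperplanes, translations, gradients and affine charts\<close>

text \<open>\<open>a \<bullet> f y\<close> is constant on \<open>V\<close>, so its derivative is
  zero. It serves for a parametrization and again for its tangent fields.\<close>

lemma has_derivative_in_hyperplane:
  fixes f :: "'a::real_normed_vector \<Rightarrow> 'b::real_inner"
  assumes "open V" "u \<in> V" "\<And>y. y \<in> V \<Longrightarrow> a \<bullet> f y = c" "(f has_derivative D) (at u)"
  shows "a \<bullet> D v = 0"
proof -
  have "((\<lambda>y. a \<bullet> f y) has_derivative (\<lambda>v. a \<bullet> D v)) (at u)"
    by (rule has_derivative_inner_right[OF assms(4)])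
  moreover have "((\<lambda>y. a \<bullet> f y) has_derivative (\<lambda>v. 0)) (at u)"
    by (rule has_derivative_transform_within_open[OF has_derivative_const[of c] assms(1,2)])
      (simp add: assms(3))
  ultimately have "(\<lambda>v. a \<bullet> D v) = (\<lambda>v. 0)" by (rule has_derivative_unique)
  then show ?thesis by metis
qed

text \<open>By the chain rule with a translation, exactly the same maps are derivatives of
  \<open>f\<close> at both points, whether or not there are any.\<close>

lemma partial_deriv_translate:
  assumes "\<And>z. f (z + d) = f z"
  shows "partial_deriv i f (x + d) = partial_deriv i f x"
proof -
  have shift: "(f has_derivative D) (at x)" if f: "\<And>z. f (z + d) = f z" "(f has_derivative D) (at (x + d))"
    for f :: "real^'a \<Rightarrow> 'b" and x d D
  proof -
    have "((\<lambda>z. z + d) has_derivative (\<lambda>h. h)) (at x)" by (auto intro!: derivative_eq_intros)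
    from has_derivative_compose[OF this f(2)] show ?thesis by (simp add: f(1))
  qed
  have "f (z + - d) = f z" for z using assms[of "z - d"] by simp
  then have "(f has_derivative D) (at (x + d)) \<longleftrightarrow> (f has_derivative D) (at x)" for D
    using shift[of f d D x] shift[of f "- d" D "x + d"] assms by auto
  then show ?thesis by (simp add: partial_deriv_def frechet_derivative_def)
qed

lemma christoffel_translate:
  assumes "\<And>z. G (z + d) = G z"
  shows "christoffel G k i j (x + d) = christoffel G k i j x"
  using partial_deriv_translate[where f = "\<lambda>y. G y $ p $ q" and d = d for p q] assms
  by (simp add: christoffel_def)

text \<open>Positive definiteness makes the vector representing the differential unique, so the
  \<open>THE\<close> denotes it.\<close>

lemma metric_grad_eqI:
  assumes "riemannian_metric_on M G" "x \<in> M"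
    and w: "\<And>v. metric_inner G x w v = frechet_derivative f (at x) v"
  shows "metric_grad G f x = w"
  unfolding metric_grad_def
proof (rule the_equality)
  fix w' assume "\<forall>v. metric_inner G x w' v = frechet_derivative f (at x) v"
  then have "metric_inner G x (w' - w) (w' - w) = 0"
    using w by (simp add: metric_inner_def inner_diff_left)
  moreover have "0 < metric_inner G x (w' - w) (w' - w)" if "w' - w \<noteq> 0"
    using assms(1,2) that unfolding riemannian_metric_on_def by blast
  ultimately show "w' = w" by fastforce
qed (use w in blast)

lemma isometry_onto_hyperplane:
  fixes a :: "real^3"
  assumes "a \<noteq> 0"
  obtains L :: "real^2 \<Rightarrow> real^3" where
    "linear L" "range L = {v. a \<bullet> v = 0}" "\<And>x. norm (L x) = norm x"
proof -
  have "dim (UNIV :: (real^2) set) = dim {v. a \<bullet> v = 0}"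
    by (simp add: dim_hyperplane assms)
  from isometries_subspaces[OF subspace_UNIV subspace_hyperplane this]
  show thesis using that by (metis UNIV_I)
qed

text \<open>The derivative is \<open>L\<close> everywhere, so all further derivatives are those of
  constants; a linear left inverse of \<open>L\<close> provides the continuous inverse.\<close>

lemma local_parametrization_affine:
  fixes L :: "real^2 \<Rightarrow> real^'n"
  assumes L: "linear L" "inj L"
  shows "local_parametrization (range (\<lambda>u. p + L u)) UNIV (\<lambda>u. p + L u)"
proof -
  let ?\<phi> = "\<lambda>u. p + L u"
  have hd: "(?\<phi> has_derivative L) (at u)" for u
    using linear_imp_has_derivative[OF L(1)] by (auto intro!: derivative_eq_intros)
  have fd: "frechet_derivative ?\<phi> (at u) = L" for u
    using frechet_derivative_at[OF hd] by simp
  have cont: "continuous_on UNIV ?\<phi>"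
    using hd has_derivative_continuous continuous_at_imp_continuous_on by blast
  have "higher_differentiable_on UNIV ?\<phi> n" for n
  proof (cases n)
    case 0
    then show ?thesis using cont by simp
  next
    case (Suc m)
    then show ?thesis using hd
      by (auto simp: fd higher_differentiable_on_const intro: differentiableI)
  qed
  then have sm: "smooth_on UNIV ?\<phi>" by (simp add: smooth_on_def)
  obtain L' where L': "linear L'" "L' \<circ> L = id"
    using linear_injective_left_inverse[OF L] by blast
  have L'L: "L' (L x) = x" for x using pointfree_idE[OF L'(2)] .
  have "homeomorphism UNIV (range ?\<phi>) ?\<phi> (\<lambda>x. L' (x - p))"
  proof (rule homeomorphismI)
    show "continuous_on UNIV ?\<phi>"
      by (rule cont)
    show "continuous_on (range ?\<phi>) (\<lambda>x. L' (x - p))"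
      by (rule linear_continuous_on_compose[OF _ L'(1)]) (intro continuous_on_diff continuous_on_id continuous_on_const)
  qed (auto simp: L'L)
  then show ?thesis
    using L(2) sm unfolding local_parametrization_def fd by auto
qed

section \<open>Diagonal metrics on a slab\<close>

lemma linear_fn_has_derivative: "(linear_fn \<alpha> has_derivative linear_fn \<alpha>) (at x)"
  by (rule bounded_linear_imp_has_derivative[OF bounded_linear_linear_fn])

lemma slab_metric_mult: "(slab_metric \<alpha> l x *v v) $ s = (l s (linear_fn \<alpha> x))\<^sup>2 * v $ s"
proof -
  have "slab_metric \<alpha> l x $ s $ j * v $ j = (if s = j then (l s (linear_fn \<alpha> x))\<^sup>2 * v $ j else 0)"
    for j by (simp add: slab_metric_def)
  then show ?thesis by (simp add: matrix_vector_mult_def)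
qed

lemma slab_metric_inner:
  "metric_inner (slab_metric \<alpha> l) x v w = (\<Sum>s\<in>UNIV. (l s (linear_fn \<alpha> x))\<^sup>2 * v $ s * w $ s)"
  by (simp add: metric_inner_def inner_vec_def slab_metric_mult mult_ac)

section \<open>Gradient, Christoffel symbols and geodesic parallelism\<close>

locale slab_geometry =
  fixes \<alpha> :: "real^3" and \<xi>1 \<xi>2 :: real and l :: "3 \<Rightarrow> real \<Rightarrow> real"
  assumes \<alpha>_nonzero: "\<alpha> \<noteq> 0"
    and l_smooth: "\<And>s. smooth_on {\<xi>1<..<\<xi>2} (l s)"
    and l_pos: "\<And>s \<xi>. \<xi> \<in> {\<xi>1<..<\<xi>2} \<Longrightarrow> 0 < l s \<xi>"
begin

abbreviation U :: "(real^3) set" where "U \<equiv> slab \<alpha> \<xi>1 \<xi>2"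
abbreviation G :: "3 metric" where "G \<equiv> slab_metric \<alpha> l"
abbreviation f :: "real^3 \<Rightarrow> real" where "f \<equiv> linear_fn \<alpha>"

lemma riemannian: "riemannian_metric_on U G"
  by (rule riemannian_metric_on_slab[OF l_smooth l_pos])

lemma metric_inner_pos: "x \<in> U \<Longrightarrow> v \<noteq> 0 \<Longrightarrow> 0 < metric_inner G x v v"
  using riemannian unfolding riemannian_metric_on_def by blast

lemma l_nonzero: "x \<in> U \<Longrightarrow> l s (f x) \<noteq> 0"
  using l_pos[of "f x" s] by (simp add: slab_def)

text \<open>The differential of \<open>f\<close> has components \<alpha>; raising the index with a
  diagonal metric divides each by its diagonal entry.\<close>

lemma metric_grad_linear_fn:
  assumes "x \<in> U"
  shows "metric_grad G f x = (\<chi> s. \<alpha> $ s / (l s (f x))\<^sup>2)"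
proof (rule metric_grad_eqI[OF riemannian assms])
  show "metric_inner G x (\<chi> s. \<alpha> $ s / (l s (f x))\<^sup>2) v = frechet_derivative f (at x) v" for v
    using frechet_derivative_at[OF linear_fn_has_derivative[of \<alpha> x], symmetric] l_nonzero[OF assms]
    by (simp add: slab_metric_inner linear_fn_def)
qed

lemma metric_mult_grad: "x \<in> U \<Longrightarrow> G x *v metric_grad G f x = \<alpha>"
  by (simp add: vec_eq_iff slab_metric_mult metric_grad_linear_fn l_nonzero)

lemma metric_norm_grad_pos:
  assumes "x \<in> U"
  shows "0 < metric_norm G x (metric_grad G f x)"
proof -
  have "metric_grad G f x \<noteq> 0" using metric_mult_grad[OF assms] \<alpha>_nonzero by force
  then show ?thesis using metric_inner_pos[OF assms] by (simp add: metric_norm_def)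
qed

lemma slab_metric_eq: "f x = f y \<Longrightarrow> G x = G y"
  by (simp add: slab_metric_def cong: if_cong)

lemma metric_grad_eq: "x \<in> U \<Longrightarrow> y \<in> U \<Longrightarrow> f x = f y \<Longrightarrow> metric_grad G f x = metric_grad G f y"
  by (simp add: metric_grad_linear_fn)

lemma metric_norm_grad_eq:
  "x \<in> U \<Longrightarrow> y \<in> U \<Longrightarrow> f x = f y \<Longrightarrow>
    metric_norm G x (metric_grad G f x) = metric_norm G y (metric_grad G f y)"
  by (simp add: metric_norm_def metric_inner_def metric_grad_eq[of x y] slab_metric_eq[of x y])

text \<open>Translation by \<open>x - y\<close> preserves \<open>f\<close> and hence
  \<open>G\<close> on the whole space. Thus also the derivatives of \<open>G\<close> transversal to
  the level planes agree at the two points.\<close>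

lemma christoffel_eq:
  assumes "f x = f y"
  shows "christoffel G k i j x = christoffel G k i j y"
proof -
  have "f (z + (x - y)) = f z" for z
    using assms by (simp add: linear_fn_eq_inner inner_add_right inner_diff_right)
  then have "G (z + (x - y)) = G z" for z by (rule slab_metric_eq)
  from christoffel_translate[of G "x - y", OF this, of k i j y] show ?thesis by simp
qed

text \<open>The metric and the gradient depend on the value of \<open>f\<close> alone, and the
  gradient does not vanish since \<alpha> is nonzero.\<close>

lemma geodesically_parallel: "geodesically_parallel_levels G U f"
  unfolding geodesically_parallel_levels_def
proof (intro conjI ballI)
  show "riemannian_metric_on U G" by (rule riemannian)
  show "f differentiable at x" for x using linear_fn_has_derivative by (rule differentiableI)
  fix c assume "c \<in> f ` U"
  then obtain x where x: "x \<in> U" "c = f x" by blast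
  show "\<exists>k. k \<noteq> 0 \<and> (\<forall>y\<in>level_set U f c. metric_norm G y (metric_grad G f y) = k)"
  proof (intro exI[of _ "metric_norm G x (metric_grad G f x)"] conjI ballI)
    show "metric_norm G x (metric_grad G f x) \<noteq> 0" using metric_norm_grad_pos[OF x(1)] by simp
    fix y assume "y \<in> level_set U f c"
    then show "metric_norm G y (metric_grad G f y) = metric_norm G x (metric_grad G f x)"
      using x by (intro metric_norm_grad_eq) (simp_all add: level_set_def)
  qed
qed

end

section \<open>A single level plane and its constant data\<close>

locale slab_level = slab_geometry +
  fixes \<xi>0 :: real
  assumes \<xi>0: "\<xi>0 \<in> {\<xi>1<..<\<xi>2}"
begin

abbreviation P :: "(real^3) set" where "P \<equiv> level_set U f \<xi>0"

text \<open>The slab cuts nothing off the plane, because \<open>\<xi>0\<close> lies strictly between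
  the two bounds.\<close>

lemma level_eq_hyperplane: "P = {x. \<alpha> \<bullet> x = \<xi>0}"
  using \<xi>0 by (auto simp: level_set_def slab_def linear_fn_eq_inner)

lemma level_in_slab: "x \<in> P \<Longrightarrow> x \<in> U" and level_value: "x \<in> P \<Longrightarrow> f x = \<xi>0"
  by (auto simp: level_set_def)

text \<open>Foot of the perpendicular from the origin, the base point where all data constant along
  the plane are evaluated.\<close>

definition p0 :: "real^3" where "p0 = (\<xi>0 / (\<alpha> \<bullet> \<alpha>)) *\<^sub>R \<alpha>"

lemma p0: "p0 \<in> P"
  using \<alpha>_nonzero by (simp add: p0_def level_eq_hyperplane)

abbreviation C :: "real^3^3" where "C \<equiv> G p0"

lemma metric_on_level: "x \<in> P \<Longrightarrow> G x = C"
  by (rule slab_metric_eq) (simp add: level_value p0)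

lemma C_pos: "v \<noteq> 0 \<Longrightarrow> 0 < v \<bullet> (C *v v)"
  using metric_inner_pos[OF level_in_slab[OF p0]] by (simp add: metric_inner_def)

lemma C_sym: "transpose C = C"
  using riemannian level_in_slab[OF p0] unfolding riemannian_metric_on_def by blast

definition \<nu> :: "real^3" where "\<nu> = unit_grad G f p0"

lemma unit_grad_on_level: "x \<in> P \<Longrightarrow> unit_grad G f x = \<nu>"
  using metric_grad_eq[of x p0] metric_norm_grad_eq[of x p0] level_value level_in_slab p0
  by (simp add: unit_grad_def \<nu>_def)

text \<open>Lowering the index turns the normal into a multiple of \<alpha>, so orthogonality to
  \<open>\<nu>\<close> in the metric is Euclidean orthogonality to \<alpha>.\<close>

lemma C_mult_\<nu>: "C *v \<nu> = \<alpha> /\<^sub>R metric_norm G p0 (metric_grad G f p0)"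
  by (simp add: \<nu>_def unit_grad_def matrix_vector_mult_scaleR metric_mult_grad level_in_slab[OF p0])

lemma metric_norm_\<nu>: "x \<in> P \<Longrightarrow> metric_norm G x \<nu> = 1"
proof -
  let ?w = "metric_grad G f p0"
  let ?m = "metric_norm G p0 ?w"
  assume "x \<in> P"
  then have "metric_norm G x \<nu> = metric_norm G p0 \<nu>"
    by (simp add: metric_norm_def metric_inner_def metric_on_level)
  also have "\<dots> = sqrt (metric_inner G p0 ?w ?w / ?m\<^sup>2)"
  proof -
    have "metric_inner G p0 (?w /\<^sub>R m) (?w /\<^sub>R m) = metric_inner G p0 ?w ?w / m\<^sup>2" for m
      by (simp add: metric_inner_def matrix_vector_mult_scaleR power2_eq_square divide_inverse)
    then show ?thesis
      unfolding metric_norm_def[of G p0 \<nu>] unfolding \<nu>_def unit_grad_def by (rule arg_cong)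
  qed
  also have "\<dots> = ?m / \<bar>?m\<bar>" by (simp add: real_sqrt_divide metric_norm_def[of G p0 ?w])
  also have "\<dots> = 1" using metric_norm_grad_pos[OF level_in_slab[OF p0]] by simp
  finally show ?thesis .
qed

lemma metric_inner_\<nu>:
  assumes "x \<in> P" "\<alpha> \<bullet> v = 0"
  shows "metric_inner G x v \<nu> = 0" "metric_inner G x \<nu> v = 0"
proof -
  show "metric_inner G x v \<nu> = 0"
    using assms by (simp add: metric_inner_def metric_on_level C_mult_\<nu> inner_commute)
  then show "metric_inner G x \<nu> v = 0"
    using assms by (simp add: metric_inner_def metric_on_level)
      (metis C_sym dot_lmul_matrix inner_commute transpose_matrix_vector)
qed

text \<open>A reference frame of the plane, chosen once, so that the value of the mean curvature can
  be named before any parametrization is given.\<close>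

definition L :: "real^2 \<Rightarrow> real^3" where
  "L = (SOME L. linear L \<and> range L = {v. \<alpha> \<bullet> v = 0} \<and> (\<forall>x. norm (L x) = norm x))"

lemma linear_L: "linear L" and range_L: "range L = {v. \<alpha> \<bullet> v = 0}" and norm_L: "norm (L x) = norm x"
proof -
  have "\<exists>L :: real^2 \<Rightarrow> real^3. linear L \<and> range L = {v. \<alpha> \<bullet> v = 0} \<and> (\<forall>x. norm (L x) = norm x)"
    using isometry_onto_hyperplane[OF \<alpha>_nonzero] by metis
  from someI_ex[OF this] show "linear L" "range L = {v. \<alpha> \<bullet> v = 0}" "norm (L x) = norm x"
    unfolding L_def by blast+
qed

lemma inj_L: "inj L"
  using linear_L norm_L by (metis linear_injective_0 norm_eq_zero)

text \<open>One affine chart covers the plane. Existence of a chart keeps the curvature statements,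
  which quantify over all charts, from being vacuous.\<close>

lemma regular_surface_level: "regular_surface P"
proof -
  have "range (\<lambda>u. p0 + L u) = P"
  proof
    have "\<alpha> \<bullet> L u = 0" for u using range_L by blast
    then show "range (\<lambda>u. p0 + L u) \<subseteq> P"
      using p0 by (auto simp: level_eq_hyperplane inner_add_right)
    show "P \<subseteq> range (\<lambda>u. p0 + L u)"
    proof
      fix x assume "x \<in> P"
      then have "\<alpha> \<bullet> (x - p0) = 0" using p0 by (simp add: level_eq_hyperplane inner_diff_right)
      then obtain u where "x - p0 = L u" using range_L by blast
      then have "x = p0 + L u" by (simp add: algebra_simps)
      then show "x \<in> range (\<lambda>u. p0 + L u)" by blast
    qed
  qed
  then have "local_parametrization P UNIV (\<lambda>u. p0 + L u)"
    using local_parametrization_affine[OF linear_L inj_L, of p0] by simp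
  moreover have "p \<in> (\<lambda>u. p0 + L u) ` UNIV" if "p \<in> P" for p
    using that \<open>range (\<lambda>u. p0 + L u) = P\<close> by simp
  ultimately show ?thesis unfolding regular_surface_def by blast
qed

text \<open>Normal component of the Christoffel term of the covariant derivative, frozen at
  \<open>p0\<close>. On tangent vectors it is the second fundamental form of the plane.\<close>

definition \<beta> :: "real^3 \<Rightarrow> real^3 \<Rightarrow> real" where
  "\<beta> X Y = (\<chi> k. \<Sum>a\<in>UNIV. \<Sum>b\<in>UNIV. christoffel G k a b p0 * X $ a * Y $ b) \<bullet> (C *v \<nu>)"

lemma bilinear_\<beta>: "bilinear \<beta>"
proof -
  have eq: "\<beta> X Y = (\<Sum>k\<in>UNIV. \<Sum>a\<in>UNIV. \<Sum>b\<in>UNIV.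
      christoffel G k a b p0 * (C *v \<nu>) $ k * X $ a * Y $ b)" for X Y
    by (simp add: \<beta>_def inner_vec_def sum_distrib_left mult_ac)
  show ?thesis
    unfolding bilinear_def
    by (intro conjI allI linearI)
      (simp_all add: eq distrib_left distrib_right sum.distrib sum_distrib_left mult_ac)
qed

lemma bilinear_C: "bilinear (\<lambda>x y. x \<bullet> (C *v y))"
  unfolding bilinear_def
  by (auto intro!: linearI simp: inner_add_left inner_add_right matrix_vector_right_distrib matrix_vector_mult_scaleR)

text \<open>The mean curvature computed in the reference frame \<open>L\<close>.\<close>

definition H :: real where
  "H = trace (matrix_inv (\<chi> i j. L (axis i 1) \<bullet> (C *v L (axis j 1)))
    ** (\<chi> i j. \<beta> (L (axis i 1)) (L (axis j 1)))) / 2"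

section \<open>An arbitrary local parametrization of the level plane\<close>

context
  fixes V :: "(real^2) set" and \<phi> :: "real^2 \<Rightarrow> real^3"
  assumes param: "local_parametrization P V \<phi>"
begin

lemma smooth_param: "smooth_on V \<phi>" and inj_deriv: "u \<in> V \<Longrightarrow> inj (frechet_derivative \<phi> (at u))"
  using param by (auto simp: local_parametrization_def)

lemma open_dom: "open V"
  using smooth_param by (simp add: smooth_on_def)

lemma param_in_level: "u \<in> V \<Longrightarrow> \<phi> u \<in> P"
  using param openin_imp_subset unfolding local_parametrization_def by blast

lemma deriv_in_hyperplane:
  assumes "u \<in> V"
  shows "\<alpha> \<bullet> frechet_derivative \<phi> (at u) v = 0"
  by (rule has_derivative_in_hyperplane[OF open_dom assms, of \<alpha> \<phi> \<xi>0])
    (use param_in_level[unfolded level_eq_hyperplane] smooth_on_has_derivative[OF smooth_param assms]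
      in simp_all)

lemma second_deriv_in_hyperplane:
  assumes "u \<in> V"
  shows "\<alpha> \<bullet> partial_deriv i (partial_deriv j \<phi>) u = 0"
  unfolding partial_deriv_def[of i]
proof (rule has_derivative_in_hyperplane[OF open_dom assms])
  show "\<alpha> \<bullet> partial_deriv j \<phi> y = 0" if "y \<in> V" for y
    using deriv_in_hyperplane[OF that] by (simp add: partial_deriv_def)
qed (rule smooth_on_has_derivative[OF smooth_on_partial_deriv[OF smooth_param] assms])

text \<open>An injective image of a 2-dimensional space inside a 2-dimensional plane fills it. Hence
  second derivatives, which lie in that plane, are tangential.\<close>

lemma range_deriv:
  assumes "u \<in> V"
  shows "range (frechet_derivative \<phi> (at u)) = {v. \<alpha> \<bullet> v = 0}"
proof (rule subspace_dim_equal)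
  let ?D = "frechet_derivative \<phi> (at u)"
  have lin: "linear ?D"
    using smooth_on_has_derivative[OF smooth_param assms] has_derivative_linear by blast
  then show "subspace (range ?D)" using linear_subspace_image subspace_UNIV by blast
  show "subspace {v. \<alpha> \<bullet> v = 0}" by (rule subspace_hyperplane)
  show "range ?D \<subseteq> {v. \<alpha> \<bullet> v = 0}" using deriv_in_hyperplane[OF assms] by blast
  have "dim (range ?D) = dim (UNIV :: (real^2) set)"
    using dim_image_eq[OF lin, of UNIV] inj_deriv[OF assms] by simp
  then show "dim {v. \<alpha> \<bullet> v = 0} \<le> dim (range ?D)"
    by (simp add: dim_hyperplane \<alpha>_nonzero)
qed

interpretation flat: totally_geodesic_in_constant_metric G C V \<phi>
  by unfold_locales
    (simp_all add: smooth_param inj_deriv range_deriv second_deriv_in_hyperplane C_sym C_pos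
      metric_on_level param_in_level)

lemma gaussian_curvature_eq_0: "u \<in> V \<Longrightarrow> gaussian_curvature (induced_metric G \<phi>) u = 0"
  by (simp add: gaussian_curvature_def flat.riemann_curv_induced_eq_0)

text \<open>The second derivative of \<phi> is orthogonal to the normal, so only the Christoffel
  term survives; its coefficients and the metric agree with those at \<open>p0\<close>.\<close>

lemma second_fundamental_form_eq:
  assumes "u \<in> V"
  shows "second_fundamental_form G \<phi> \<nu> u = (\<chi> i j. \<beta> (partial_deriv i \<phi> u) (partial_deriv j \<phi> u))"
proof -
  have "f (\<phi> u) = f p0" using level_value param_in_level[OF assms] p0 by simp
  note chr = christoffel_eq[OF this]
  show ?thesis
    using metric_inner_\<nu>(1)[OF param_in_level[OF assms] second_deriv_in_hyperplane[OF assms]]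
      metric_on_level[OF param_in_level[OF assms]]
    by (simp add: second_fundamental_form_def cov_deriv_param_def \<beta>_def chr metric_inner_def
        inner_add_left)
qed

text \<open>
  The frame of \<open>\<phi>\<close> is a change of basis of the fixed frame of \<^term>\<open>L\<close>, and both the induced metric
  and the second fundamental form come from bilinear forms that do not depend on the point.
\<close>

lemma mean_curvature_param_eq:
  assumes "u \<in> V"
  shows "mean_curvature_param G \<phi> \<nu> u = H"
proof -
  let ?e = "\<lambda>i. partial_deriv i \<phi> u" and ?L = "\<lambda>i. L (axis i 1)"
  let ?g = "\<chi> i j. ?L i \<bullet> (C *v ?L j)" and ?h = "\<chi> i j. \<beta> (?L i) (?L j)"
  have "\<exists>a. ?e i = L a" for i
    using range_L deriv_in_hyperplane[OF assms] unfolding partial_deriv_def by blast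
  then obtain a where a: "?e i = L (a i)" for i by metis
  define A where "A = (\<chi> k i. a i $ k)"
  have e: "?e i = (\<Sum>k\<in>UNIV. A $ k $ i *\<^sub>R ?L k)" for i
    unfolding a A_def vec_lambda_beta by (rule linear_eq_sum_axis[OF linear_L])
  \<comment> \<open>\<open>L\<close> maps \<open>A *v x\<close> to the combination of the frame of
    \<phi> with coefficients \<open>x\<close>, so a kernel vector of \<open>A\<close> would be a
    linear relation in that frame.\<close>
  have "invertible A"
    unfolding invertible_left_inverse matrix_left_invertible_ker
  proof (intro allI impI)
    fix x assume Ax: "A *v x = 0"
    have "(\<Sum>i\<in>UNIV. x $ i *\<^sub>R ?e i) = L (\<Sum>i\<in>UNIV. x $ i *\<^sub>R a i)"
      by (simp add: a linear_sum[OF linear_L] linear_scale[OF linear_L])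
    also have "(\<Sum>i\<in>UNIV. x $ i *\<^sub>R a i) = A *v x"
      by (simp add: vec_eq_iff matrix_vector_mult_def A_def mult.commute)
    finally show "x = 0"
      using flat.frame_independent[OF assms] Ax linear_0[OF linear_L] by simp
  qed
  moreover have "invertible ?g"
  proof (rule invertible_gram_matrix[OF _ C_pos])
    fix b :: "real^2" assume "(\<Sum>k\<in>UNIV. b $ k *\<^sub>R ?L k) = 0"
    then have "L b = 0" using linear_eq_sum_axis[OF linear_L, of b] by simp
    then show "b = 0" using norm_L[of b] by simp
  qed
  moreover have "induced_metric G \<phi> u = transpose A ** ?g ** A"
    using bilinear_matrix_change_of_basis[OF bilinear_C e]
    by (simp add: induced_metric_def metric_inner_def metric_on_level param_in_level assms)
  moreover have "second_fundamental_form G \<phi> \<nu> u = transpose A ** ?h ** A"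
    using bilinear_matrix_change_of_basis[OF bilinear_\<beta> e] second_fundamental_form_eq[OF assms]
    by simp
  ultimately show ?thesis
    by (simp add: mean_curvature_param_def H_def trace_matrix_inv_congruence)
qed

end

section \<open>Curvatures of the level plane\<close>

lemma has_gaussian_curvature_level: "p \<in> P \<Longrightarrow> has_gaussian_curvature G P p 0"
  unfolding has_gaussian_curvature_def
  by (intro conjI allI impI regular_surface_level gaussian_curvature_eq_0)

text \<open>Along the plane the unit gradient is the fixed vector \<open>\<nu>\<close>, which gives
  continuity of the normal field and the same value \<open>H\<close> at every point.\<close>

lemma constant_mean_curvature_level: "constant_mean_curvature G P (unit_grad G f)"
  unfolding constant_mean_curvature_def has_mean_curvature_def
proof (intro conjI exI[of _ H] ballI allI impI)
  have "continuous_on P (\<lambda>_. \<nu>)" by (rule continuous_on_const)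
  then show "continuous_on P (unit_grad G f)"
    by (rule continuous_on_eq) (simp add: unit_grad_on_level)
  show "regular_surface P" by (rule regular_surface_level)
  fix p assume p: "p \<in> P"
  then show "p \<in> P" .
  show "metric_norm G p (unit_grad G f p) = 1"
    using p by (simp add: unit_grad_on_level metric_norm_\<nu>)
  fix V \<phi> u assume "local_parametrization P V \<phi>" "u \<in> V" "\<phi> u = p"
  then show "metric_inner G p (unit_grad G f p) (partial_deriv i \<phi> u) = 0" for i
    using p deriv_in_hyperplane
    by (simp add: unit_grad_on_level metric_inner_\<nu> partial_deriv_def)
  show "mean_curvature_param G \<phi> (unit_grad G f p) u = H"
    using p mean_curvature_param_eq \<open>local_parametrization P V \<phi>\<close> \<open>u \<in> V\<close>
    by (simp add: unit_grad_on_level)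
qed

end

theorem theorem6:
  fixes \<alpha> :: "real^3" and \<xi>1 \<xi>2 :: real and l :: "3 \<Rightarrow> real \<Rightarrow> real"
  assumes "\<alpha> \<noteq> 0"
    and "\<xi>1 < \<xi>2"
    and "\<And>s. smooth_on {\<xi>1<..<\<xi>2} (l s)"
    and "\<And>s \<xi>. \<xi> \<in> {\<xi>1<..<\<xi>2} \<Longrightarrow> 0 < l s \<xi>"
  shows "geodesically_parallel_levels (slab_metric \<alpha> l) (slab \<alpha> \<xi>1 \<xi>2) (linear_fn \<alpha>) \<and>
    (\<forall>\<xi>0\<in>{\<xi>1<..<\<xi>2}.
       (\<forall>p\<in>level_set (slab \<alpha> \<xi>1 \<xi>2) (linear_fn \<alpha>) \<xi>0.
          has_gaussian_curvature (slab_metric \<alpha> l)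
            (level_set (slab \<alpha> \<xi>1 \<xi>2) (linear_fn \<alpha>) \<xi>0) p 0) \<and>
       constant_mean_curvature (slab_metric \<alpha> l)
         (level_set (slab \<alpha> \<xi>1 \<xi>2) (linear_fn \<alpha>) \<xi>0)
         (unit_grad (slab_metric \<alpha> l) (linear_fn \<alpha>)))"
proof -
  interpret slab_geometry \<alpha> \<xi>1 \<xi>2 l
    by unfold_locales (use assms in auto)
  have "slab_level \<alpha> \<xi>1 \<xi>2 l \<xi>0" if "\<xi>0 \<in> {\<xi>1<..<\<xi>2}" for \<xi>0
    using that by unfold_locales
  then show ?thesis
    by (intro conjI ballI geodesically_parallel slab_level.has_gaussian_curvature_level
        slab_level.constant_mean_curvature_level)
qed

end
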